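(* Let $s,k$ be positive integers and let $\lambda$ be a self-conjugate partition. Then $\lambda$ is an $(s,s+1,\ldots,s+k)$-core if and only if $MD(\lambda)$ is a nice order ideal of the poset $P(s,k)$.
   Context: A partition $\lambda$ is identified with its Young diagram; it is self-conjugate if it equals its reflection in the main diagonal. The hook length of a box is the number of boxes weakly to its right in its row plus those strictly below it in its column; $MD(\lambda)$ denotes the set of hook lengths of the boxes on the main diagonal. $\lambda$ is a $t$-core if no box has hook length divisible by $t$, and an $(s,s+1,\ldots,s+k)$-core if it is a $t$-core for every $s\le t\le s+k$. Define $L(s,k)=\bigcup_{j\ge0}\{2i-1+2sj : i\in\mathbb{Z},\ jk+1\le i\le\lfloor s/2\rfloor\}$ and $R(s,k)=\bigcup_{j\ge0}\{2i-1+2sj : i\in\mathbb{Z},\ jk+\lceil(s+k)/2\rceil+1\le i\le s\}$, and $P(s,k)=L(s,k)\cup R(s,k)$, partially ordered by the order generated by the cover relations: for $x,y\in P(s,k)$, $y$ covers $x$ iff $y=x+2s+2t$ for some integer $0\le t\le k$. An order ideal is a subset $I$ such that $y\in I$ and $x\preceq y$ imply $x\in I$. An order ideal $I$ of $P(s,k)$ is nice if there are no elements $h_1,h_2\in I$ with $h_1+h_2\in\{2s,2s+2,\ldots,2s+2k\}$. *)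

theory Defs
  imports Complex_Main
begin

text \<open>A partition is the weakly decreasing list of its positive parts.  Boxes of the Young diagram
  are pairs (row, column), both counted from 0.\<close>

definition is_partition :: "nat list \<Rightarrow> bool" where
  "is_partition lam \<longleftrightarrow> sorted_wrt (\<ge>) lam \<and> (\<forall>p \<in> set lam. 0 < p)"

definition young_diagram :: "nat list \<Rightarrow> (nat \<times> nat) set" where
  "young_diagram lam = {(r, c). r < length lam \<and> c < lam ! r}"

definition self_conjugate :: "nat list \<Rightarrow> bool" where
  "self_conjugate lam \<longleftrightarrow> (young_diagram lam)\<inverse> = young_diagram lam"

definition hook_length :: "nat list \<Rightarrow> nat \<Rightarrow> nat \<Rightarrow> nat" where
  "hook_length lam r c =
     card {c'. c \<le> c' \<and> (r, c') \<in> young_diagram lam} +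
     card {r'. r < r' \<and> (r', c) \<in> young_diagram lam}"

text \<open>Main-diagonal hook lengths are regarded as integers, to compare them with elements of
  the poset.\<close>

definition MD :: "nat list \<Rightarrow> int set" where
  "MD lam = {int (hook_length lam d d) | d. (d, d) \<in> young_diagram lam}"

definition is_core :: "nat \<Rightarrow> nat list \<Rightarrow> bool" where
  "is_core t lam \<longleftrightarrow> (\<forall>(r, c) \<in> young_diagram lam. \<not> t dvd hook_length lam r c)"

definition is_consecutive_core :: "nat \<Rightarrow> nat \<Rightarrow> nat list \<Rightarrow> bool" where
  "is_consecutive_core s k lam \<longleftrightarrow> (\<forall>t \<in> {s..s + k}. is_core t lam)"

definition L_set :: "nat \<Rightarrow> nat \<Rightarrow> int set" where
  "L_set s k = (\<Union>j::nat. {2 * i - 1 + 2 * int s * int j | i::int.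
     int j * int k + 1 \<le> i \<and> i \<le> \<lfloor>real s / 2\<rfloor>})"

definition R_set :: "nat \<Rightarrow> nat \<Rightarrow> int set" where
  "R_set s k = (\<Union>j::nat. {2 * i - 1 + 2 * int s * int j | i::int.
     int j * int k + \<lceil>real (s + k) / 2\<rceil> + 1 \<le> i \<and> i \<le> int s})"

definition P_set :: "nat \<Rightarrow> nat \<Rightarrow> int set" where
  "P_set s k = L_set s k \<union> R_set s k"

definition P_covers :: "nat \<Rightarrow> nat \<Rightarrow> (int \<times> int) set" where
  "P_covers s k = {(x, y). x \<in> P_set s k \<and> y \<in> P_set s k \<and>
     (\<exists>t::int. 0 \<le> t \<and> t \<le> int k \<and> y = x + 2 * int s + 2 * t)}"

text \<open>The closure below is reflexive on all integers, hence the restriction to the ground set.\<close>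

definition P_order :: "nat \<Rightarrow> nat \<Rightarrow> (int \<times> int) set" where
  "P_order s k = (P_covers s k)\<^sup>* \<inter> P_set s k \<times> P_set s k"

definition order_ideal :: "'a set \<Rightarrow> ('a \<times> 'a) set \<Rightarrow> 'a set \<Rightarrow> bool" where
  "order_ideal A ord I \<longleftrightarrow> I \<subseteq> A \<and> (\<forall>x y. y \<in> I \<and> (x, y) \<in> ord \<longrightarrow> x \<in> I)"

text \<open>The elements \<open>h1\<close> and \<open>h2\<close> are not required to be distinct.\<close>

definition nice_order_ideal :: "nat \<Rightarrow> nat \<Rightarrow> int set \<Rightarrow> bool" where
  "nice_order_ideal s k I \<longleftrightarrow> order_ideal (P_set s k) (P_order s k) I \<and>
     \<not> (\<exists>h1 \<in> I. \<exists>h2 \<in> I. h1 + h2 \<in> {2 * int s + 2 * t | t::int. 0 \<le> t \<and> t \<le> int k})"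

lemma partial_order_P_order:
  assumes "0 < s"
  shows "partial_order_on (P_set s k) (P_order s k)"
proof -
  have mono: "x = y \<or> x < y" if "(x, y) \<in> (P_covers s k)\<^sup>*" for x y
    using that by (induction rule: rtrancl_induct) (use assms in \<open>auto simp: P_covers_def\<close>)
  have "antisym (P_order s k)"
    by (rule antisymI) (auto simp: P_order_def dest!: mono)
  moreover have "trans (P_order s k)"
    by (rule transI) (auto simp: P_order_def)
  moreover have "refl_on (P_set s k) (P_order s k)"
    by (auto simp: refl_on_def P_order_def)
  moreover have "P_order s k \<subseteq> P_set s k \<times> P_set s k"
    by (auto simp: P_order_def)
  ultimately show ?thesis
    by (simp add: partial_order_on_def preorder_on_def)
qed

end

theory Submission
  imports Defs
begin

text \<open>For \<open>i \<ge> 0\<close> put \<open>x\<^sub>i = 2 (\<lambda>\<^sub>i - i) - 1\<close>, where \<open>\<lambda>\<^sub>i = 0\<close> beyond the last row, and let \<open>S\<close> be the set of all \<open>x\<^sub>i\<close>.  Self-conjugacy makes the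
  hook length of the box \<open>(r, c)\<close> equal to \<open>(x\<^sub>r + x\<^sub>c) / 2\<close>, and \<open>(r, c)\<close> is a box iff this number
  is positive.  Moreover \<open>S\<close> contains exactly one of \<open>y\<close> and \<open>-y\<close> for every odd \<open>y\<close>, and \<open>MD(\<lambda>)\<close>
  is the positive part of \<open>S\<close>.  Hence \<open>\<lambda>\<close> is a \<open>t\<close>-core iff \<open>S\<close> is closed under \<open>y \<mapsto> y - 2t\<close>,
  which for \<open>0 < y < 2t\<close> forbids two elements of \<open>MD(\<lambda>)\<close> with sum \<open>2t\<close>.
  The poset \<open>P(s,k)\<close> consists of the positive odd numbers outside the numerical semigroup
  generated by \<open>s, \<dots>, s + k\<close>.  If \<open>h \<in> S\<close> were a sum of such generators, subtracting twice each of
  them would give \<open>-h \<in> S\<close>, a contradiction; so \<open>MD(\<lambda>) \<subseteq> P(s,k)\<close> for cores.\<close>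

section \<open>Beads of a self-conjugate partition\<close>

definition part :: "nat list \<Rightarrow> nat \<Rightarrow> nat" where
  "part lam i = (if i < length lam then lam ! i else 0)"

text \<open>Twice the half-integer \<open>part lam i - i - 1/2\<close> of the Maya diagram; doubling
  keeps it an integer.\<close>

definition bead :: "nat list \<Rightarrow> nat \<Rightarrow> int" where
  "bead lam i = 2 * (int (part lam i) - int i) - 1"

lemma young_diagram_iff: "(r, c) \<in> young_diagram lam \<longleftrightarrow> c < part lam r"
  by (auto simp: young_diagram_def part_def)

lemma part_sym:
  assumes "self_conjugate lam"
  shows "c < part lam r \<longleftrightarrow> r < part lam c"
  using assms unfolding self_conjugate_def young_diagram_iff[symmetric] by blast

lemma odd_bead: "odd (bead lam i)"
  by (simp add: bead_def)

text \<open>By symmetry \<open>part lam r - c\<close> and \<open>part lam c - r\<close> are both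
  positive or both nonpositive. The bead sum is twice their sum minus 2, hence at least 2 or at most
  -2.\<close>

lemma box_iff_bead_add_pos:
  assumes "self_conjugate lam"
  shows "(r, c) \<in> young_diagram lam \<longleftrightarrow> 0 < bead lam r + bead lam c"
  using part_sym[OF assms, of c r] by (auto simp: young_diagram_iff bead_def)

lemma bead_add_nonzero:
  assumes "self_conjugate lam"
  shows "bead lam r + bead lam c \<noteq> 0"
  using part_sym[OF assms, of c r] by (auto simp: bead_def)

lemma two_hook_length:
  assumes "self_conjugate lam" and "(r, c) \<in> young_diagram lam"
  shows "2 * int (hook_length lam r c) = bead lam r + bead lam c"
proof -
  have "{c'. c \<le> c' \<and> (r, c') \<in> young_diagram lam} = {c..<part lam r}"
    by (auto simp: young_diagram_iff)
  moreover have "{r'. r < r' \<and> (r', c) \<in> young_diagram lam} = {r<..<part lam c}"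
    using part_sym[OF assms(1)] by (auto simp: young_diagram_iff)
  moreover have "c < part lam r" "r < part lam c"
    using assms part_sym[OF assms(1)] by (auto simp: young_diagram_iff)
  ultimately show ?thesis
    by (auto simp: hook_length_def bead_def)
qed

lemma bead_or_neg_bead:
  assumes "self_conjugate lam"
  shows "2 * int b + 1 \<in> range (bead lam) \<or> - (2 * int b + 1) \<in> range (bead lam)"
proof -
  \<comment> \<open>Row \<open>i\<close> is the first not extending past the superdiagonal
    \<open>c = r + b\<close>. Either it ends on it, which gives the positive bead, or column
    \<open>i + b\<close> has exactly \<open>i\<close> boxes, which gives the negative one.\<close>
  define i where "i = (LEAST i. part lam i \<le> i + b + 1)"
  have "part lam (length lam) \<le> length lam + b + 1"
    by (simp add: part_def)
  then have i: "part lam i \<le> i + b + 1"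
    unfolding i_def by (rule LeastI)
  have less: "j + b + 1 < part lam j" if "j < i" for j
    using not_less_Least[of j "\<lambda>i. part lam i \<le> i + b + 1"] that by (auto simp: i_def)
  show ?thesis
  proof (cases "part lam i = i + b + 1")
    case True
    then have "2 * int b + 1 = bead lam i"
      by (simp add: bead_def)
    then show ?thesis by blast
  next
    case False
    have "\<not> i < part lam (i + b)"
      using i False part_sym[OF assms(1), of i "i + b"] by simp
    moreover have "i \<le> part lam (i + b)"
    proof (cases i)
      case (Suc n)
      then have "i + b < part lam n"
        using less[of n] by simp
      then show ?thesis
        using part_sym[OF assms(1), of n "i + b"] Suc by simp
    qed simp
    ultimately have "- (2 * int b + 1) = bead lam (i + b)"
      by (simp add: bead_def)
    then show ?thesis by blast
  qed
qed

lemma neg_mem_beads_iff: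
  assumes "self_conjugate lam" and "odd y"
  shows "- y \<in> range (bead lam) \<longleftrightarrow> y \<notin> range (bead lam)"
proof -
  have "y \<in> range (bead lam) \<or> - y \<in> range (bead lam)"
  proof (cases "0 \<le> y")
    case True
    with \<open>odd y\<close> have "y = 2 * int (nat (y div 2)) + 1"
      by (simp add: pos_imp_zdiv_nonneg_iff)
    then show ?thesis
      using bead_or_neg_bead[OF assms(1), of "nat (y div 2)"] by metis
  next
    case False
    then have "0 \<le> - y" "odd (- y)" using \<open>odd y\<close> by auto
    then have "- y = 2 * int (nat (- y div 2)) + 1"
      using odd_two_times_div_two_succ[of "- y"] by (simp add: pos_imp_zdiv_nonneg_iff)
    then show ?thesis
      using bead_or_neg_bead[OF assms(1), of "nat (- y div 2)"] by (metis add.inverse_inverse)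
  qed
  moreover have "\<not> (y \<in> range (bead lam) \<and> - y \<in> range (bead lam))"
    using bead_add_nonzero[OF assms(1)] by (metis add.right_inverse rangeE)
  ultimately show ?thesis by blast
qed

lemma MD_eq:
  assumes "self_conjugate lam"
  shows "MD lam = {x \<in> range (bead lam). 0 < x}"
proof -
  have "int (hook_length lam d d) = bead lam d" if "(d, d) \<in> young_diagram lam" for d
    using two_hook_length[OF assms that] by simp
  moreover have "(d, d) \<in> young_diagram lam \<longleftrightarrow> 0 < bead lam d" for d
    using box_iff_bead_add_pos[OF assms, of d d] by simp
  ultimately show ?thesis
    unfolding MD_def by (auto, metis)
qed

text \<open>If \<open>y - 2 * t\<close> is missing, its negative is a bead, and this bead and
  \<open>y\<close> span a box of hook length exactly \<open>t\<close>. Conversely, a hook length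
  \<open>t * j\<close> would lead by \<open>j\<close> subtractions from one bead to the negative of
  another.\<close>

lemma is_core_iff_beads_closed:
  assumes "self_conjugate lam" and "0 < t"
  shows "is_core t lam \<longleftrightarrow> (\<forall>y \<in> range (bead lam). y - 2 * int t \<in> range (bead lam))"
proof
  assume core: "is_core t lam"
  show "\<forall>y \<in> range (bead lam). y - 2 * int t \<in> range (bead lam)"
  proof (rule ballI, rule ccontr)
    fix y assume "y \<in> range (bead lam)" and "y - 2 * int t \<notin> range (bead lam)"
    then obtain r c where r: "y = bead lam r" and c: "- (y - 2 * int t) = bead lam c"
      using neg_mem_beads_iff[OF assms(1), of "y - 2 * int t"] odd_bead by auto
    then have sum: "bead lam r + bead lam c = 2 * int t" by simp
    then have box: "(r, c) \<in> young_diagram lam"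
      using box_iff_bead_add_pos[OF assms(1)] \<open>0 < t\<close> by simp
    then have "hook_length lam r c = t"
      using two_hook_length[OF assms(1) box] sum by simp
    then show False
      using core box by (auto simp: is_core_def)
  qed
next
  assume closed: "\<forall>y \<in> range (bead lam). y - 2 * int t \<in> range (bead lam)"
  have iter: "y - 2 * int t * int j \<in> range (bead lam)" if "y \<in> range (bead lam)" for y j
  proof (induction j)
    case (Suc j)
    then have "y - 2 * int t * int j - 2 * int t \<in> range (bead lam)"
      using closed by blast
    then show ?case by (simp add: algebra_simps)
  qed (use that in simp)
  have "\<not> t dvd hook_length lam r c" if box: "(r, c) \<in> young_diagram lam" for r c
  proof
    assume "t dvd hook_length lam r c"
    then obtain j where "hook_length lam r c = t * j" by blast
    then have "bead lam r - 2 * int t * int j = - bead lam c"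
      using two_hook_length[OF assms(1) box] by simp
    then have "- bead lam c \<in> range (bead lam)"
      using iter[of "bead lam r" j] by auto
    then show False
      using neg_mem_beads_iff[OF assms(1) odd_bead] by blast
  qed
  then show "is_core t lam"
    by (auto simp: is_core_def)
qed

section \<open>The poset as the odd gaps of a numerical semigroup\<close>

lemma L_set_iff:
  "h \<in> L_set s k \<longleftrightarrow>
     odd h \<and> (\<exists>j::nat. int (s + k) * (2 * int j) < h \<and> h < int s * (2 * int j + 1))"
proof -
  have fl: "\<lfloor>real s / 2\<rfloor> = int s div 2"
    using floor_divide_of_nat_eq[of s 2] by (simp add: zdiv_int)
  have "(\<exists>i. h = 2 * i - 1 + 2 * int s * int j \<and> int j * int k + 1 \<le> i \<and> i \<le> int s div 2) \<longleftrightarrow>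
     odd h \<and> int (s + k) * (2 * int j) < h \<and> h < int s * (2 * int j + 1)" for j
  proof -
    \<comment> \<open>Naming the products makes the claim linear, as \<open>presburger\<close>
      requires.\<close>
    define a where "a = int s * int j"
    define b where "b = int j * int k"
    have 1: "2 * int s * int j = 2 * a" "int (s + k) * (2 * int j) = 2 * a + 2 * b"
      "int s * (2 * int j + 1) = 2 * a + int s"
      by (simp_all add: a_def b_def algebra_simps)
    show ?thesis
      unfolding 1 b_def[symmetric] by presburger
  qed
  then show ?thesis
    unfolding L_set_def fl by auto
qed

lemma R_set_iff:
  "h \<in> R_set s k \<longleftrightarrow>
     odd h \<and> (\<exists>j::nat. int (s + k) * (2 * int j + 1) < h \<and> h < int s * (2 * int j + 2))"
proof -
  have ce: "\<lceil>real (s + k) / 2\<rceil> = (int (s + k) + 1) div 2"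
  proof (rule ceiling_unique)
    define q where "q = (int (s + k) + 1) div 2"
    have "int (s + k) \<le> 2 * q" "2 * q \<le> int (s + k) + 1"
      unfolding q_def by presburger+
    then have "real_of_int (int (s + k)) \<le> real_of_int (2 * q)"
      "real_of_int (2 * q) \<le> real_of_int (int (s + k) + 1)"
      by (simp_all only: of_int_le_iff)
    then show "real_of_int q - 1 < real (s + k) / 2" "real (s + k) / 2 \<le> real_of_int q"
      by simp_all
  qed
  have "(\<exists>i. h = 2 * i - 1 + 2 * int s * int j \<and>
       int j * int k + (int (s + k) + 1) div 2 + 1 \<le> i \<and> i \<le> int s) \<longleftrightarrow>
     odd h \<and> int (s + k) * (2 * int j + 1) < h \<and> h < int s * (2 * int j + 2)" for j
  proof -
    define a where "a = int s * int j"
    define b where "b = int j * int k"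
    have 1: "2 * int s * int j = 2 * a"
      "int (s + k) * (2 * int j + 1) = 2 * a + 2 * b + int (s + k)"
      "int s * (2 * int j + 2) = 2 * a + 2 * int s"
      by (simp_all add: a_def b_def algebra_simps)
    show ?thesis
      unfolding 1 b_def[symmetric] by presburger
  qed
  then show ?thesis
    unfolding R_set_def ce by auto
qed

text \<open>Sums of \<open>m\<close> generators fill the interval from \<open>s * m\<close> to
  \<open>(s + k) * m\<close>, so these are the odd numbers strictly between consecutive intervals.
  \<open>L_set\<close> covers even \<open>m\<close>, \<open>R_set\<close> odd
  \<open>m\<close>.\<close>

lemma P_set_iff:
  "h \<in> P_set s k \<longleftrightarrow>
     odd h \<and> (\<exists>m::nat. int (s + k) * int m < h \<and> h < int s * (int m + 1))"
  (is "_ \<longleftrightarrow> odd h \<and> (\<exists>m. ?Q m)")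
proof -
  have "(\<exists>m. ?Q m) \<longleftrightarrow> (\<exists>j. ?Q (2 * j)) \<or> (\<exists>j. ?Q (2 * j + 1))"
    by (metis oddE evenE)
  then show ?thesis
    unfolding P_set_def Un_iff L_set_iff R_set_iff by (auto simp: add.commute)
qed

lemma subtract_twice_generators:
  assumes closed: "\<And>y t. y \<in> S \<Longrightarrow> s \<le> t \<Longrightarrow> t \<le> s + k \<Longrightarrow> y - 2 * t \<in> S"
    and "0 \<le> k" and "y \<in> S" and "s * int m \<le> n" and "n \<le> (s + k) * int m"
  shows "y - 2 * n \<in> (S :: int set)"
  using assms(3-5)
proof (induction m arbitrary: y n)
  case (Suc m)
  \<comment> \<open>Greedy choice: the least generator whose removal leaves at most
    \<open>(s + k) * m\<close>.\<close>
  define t where "t = max s (n - (s + k) * int m)"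
  have "s \<le> t" "t \<le> s + k" "s * int m \<le> n - t" "n - t \<le> (s + k) * int m"
    using Suc.prems(2,3) \<open>0 \<le> k\<close> mult_nonneg_nonneg[of k "int m"]
    by (auto simp: t_def algebra_simps max_def)
  then have "y - 2 * t - 2 * (n - t) \<in> S"
    by (intro Suc.IH closed Suc.prems(1))
  then show ?case by simp
qed simp

theorem theorem2p5:
  fixes s k :: nat and lam :: "nat list"
  assumes "0 < s" and "0 < k"
    and "is_partition lam" and "self_conjugate lam"
  shows "is_consecutive_core s k lam \<longleftrightarrow> nice_order_ideal s k (MD lam)"
proof -
  let ?S = "range (bead lam)"
  have MD: "x \<in> MD lam \<longleftrightarrow> x \<in> ?S \<and> 0 < x" for x
    using MD_eq[OF assms(4)] by auto
  have odd_S: "odd x" if "x \<in> ?S" for x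
    using that odd_bead by auto
  note neg = neg_mem_beads_iff[OF assms(4)]
  have "is_consecutive_core s k lam \<longleftrightarrow> (\<forall>t \<in> {s..s + k}. \<forall>y \<in> ?S. y - 2 * int t \<in> ?S)"
    using is_core_iff_beads_closed[OF assms(4)] \<open>0 < s\<close> by (auto simp: is_consecutive_core_def)
  also have "\<dots> \<longleftrightarrow> (\<forall>t \<in> {int s..int s + int k}. \<forall>y \<in> ?S. y - 2 * t \<in> ?S)"
  proof -
    have "{int s..int s + int k} = int ` {s..s + k}"
      by (simp add: image_int_atLeastAtMost)
    then show ?thesis by simp
  qed
  also have "\<dots> \<longleftrightarrow> nice_order_ideal s k (MD lam)"
  proof
    assume *: "\<forall>t \<in> {int s..int s + int k}. \<forall>y \<in> ?S. y - 2 * t \<in> ?S"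
    then have closed: "y - 2 * t \<in> ?S" if "y \<in> ?S" "int s \<le> t" "t \<le> int s + int k" for y t
      using * that by (meson atLeastAtMost_iff)
    have "h \<in> P_set s k" if "h \<in> MD lam" for h
    proof -
      have h: "h \<in> ?S" "0 < h" using that MD by auto
      \<comment> \<open>As \<open>h < s * (m + 1)\<close>, \<open>h\<close> lies in gap
        \<open>m\<close> unless it is a sum of \<open>m\<close> generators.\<close>
      define m where "m = nat (h div int s)"
      have "int m = h div int s"
        using h \<open>0 < s\<close> by (simp add: m_def pos_imp_zdiv_nonneg_iff)
      then have "int s * int m + h mod int s = h" by simp
      moreover have "0 \<le> h mod int s" "h mod int s < int s"
        using \<open>0 < s\<close> by simp_all
      ultimately have m: "int s * int m \<le> h" "h < int s * (int m + 1)"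
        unfolding distrib_left by linarith+
      have "\<not> h \<le> (int s + int k) * int m"
      proof
        assume "h \<le> (int s + int k) * int m"
        then have "h - 2 * h \<in> ?S"
          using closed h m by (intro subtract_twice_generators[of ?S "int s" "int k" h m h]) auto
        then show False using neg odd_S h by auto
      qed
      then show ?thesis
        unfolding P_set_iff using m odd_S[OF h(1)] by (auto intro!: exI[of _ m])
    qed
    moreover have "x \<in> MD lam" if "y \<in> MD lam" "(x, y) \<in> P_order s k" for x y
    proof -
      have "(x, y) \<in> (P_covers s k)\<^sup>*" using that by (simp add: P_order_def)
      then show ?thesis
      proof (induction rule: converse_rtrancl_induct)
        case (step x z)
        then obtain t where t: "0 \<le> t" "t \<le> int k" "z = x + 2 * int s + 2 * t" "x \<in> P_set s k"
          by (auto simp: P_covers_def)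
        have "z - 2 * (int s + t) \<in> ?S"
          using step t MD by (intro closed) auto
        moreover have "0 < x"
          using t(4) by (auto simp: P_set_iff intro: le_less_trans[rotated])
        ultimately show ?case
          using t MD by simp
      qed (use that in simp)
    qed
    moreover have False
      if "h1 \<in> MD lam" "h2 \<in> MD lam" "h1 + h2 = 2 * int s + 2 * t" "0 \<le> t" "t \<le> int k" for h1 h2 t
    proof -
      have "h1 - 2 * (int s + t) \<in> ?S"
        using that MD by (intro closed) auto
      moreover have "h1 - 2 * (int s + t) = - h2" using that(3) by simp
      ultimately show False using neg odd_S that(2) MD by auto
    qed
    ultimately show "nice_order_ideal s k (MD lam)"
      unfolding nice_order_ideal_def order_ideal_def by blast
  next
    assume nice: "nice_order_ideal s k (MD lam)"
    have descend: "y - 2 * t \<in> MD lam"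
      if t: "int s \<le> t" "t \<le> int s + int k" and y: "y \<in> MD lam" "2 * t < y" for y t
    proof -
      have yP: "y \<in> P_set s k"
        using nice y by (auto simp: nice_order_ideal_def order_ideal_def)
      then obtain m where "odd y" and m: "int (s + k) * int m < y" "y < int s * (int m + 1)"
        by (auto simp: P_set_iff)
      \<comment> \<open>Since \<open>2 * s <= 2 * t < y\<close>, the gap index is at least 2;
        subtracting \<open>2 * t\<close> moves \<open>y\<close> from gap \<open>m\<close> into gap
        \<open>m - 2\<close>, hence down one cover relation.\<close>
      have "int s * 2 < int s * (int m + 1)"
        using m y t by simp
      then have "2 \<le> m" using \<open>0 < s\<close> by simp
      then obtain n where n: "m = n + 2" by (metis add.commute le_Suc_ex)
      have "int (s + k) * int n < y - 2 * t" "y - 2 * t < int s * (int n + 1)"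
        using m t by (simp_all add: n algebra_simps)
      then have xP: "y - 2 * t \<in> P_set s k"
        using \<open>odd y\<close> unfolding P_set_iff by auto
      have "(y - 2 * t, y) \<in> P_covers s k"
        using t xP yP by (auto simp: P_covers_def intro!: exI[of _ "t - int s"])
      then have "(y - 2 * t, y) \<in> P_order s k"
        using xP yP by (auto simp: P_order_def)
      then show ?thesis
        using nice y by (auto simp: nice_order_ideal_def order_ideal_def)
    qed
    have no_sum: "h1 + h2 \<noteq> 2 * t"
      if "int s \<le> t" "t \<le> int s + int k" "h1 \<in> MD lam" "h2 \<in> MD lam" for h1 h2 t
    proof
      assume "h1 + h2 = 2 * t"
      then have "h1 + h2 = 2 * int s + 2 * (t - int s)" by simp
      moreover have "0 \<le> t - int s" "t - int s \<le> int k" using that by auto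
      ultimately show False
        using nice that(3,4) unfolding nice_order_ideal_def by blast
    qed
    show "\<forall>t \<in> {int s..int s + int k}. \<forall>y \<in> ?S. y - 2 * t \<in> ?S"
    proof (intro ballI, rule ccontr)
      fix t y assume t: "t \<in> {int s..int s + int k}" and y: "y \<in> ?S" and "y - 2 * t \<notin> ?S"
      then have z: "2 * t - y \<in> ?S"
        using neg[of "y - 2 * t"] odd_S[OF y] by simp
      have "y \<noteq> 0" "y \<noteq> 2 * t" using odd_S[OF y] by auto
      \<comment> \<open>Above \<open>2 * t\<close>, \<open>y\<close> itself descends. Between,
        \<open>y\<close> and \<open>2 * t - y\<close> are diagonal hooks with forbidden sum. Below
        0, \<open>2 * t - y\<close> descends to \<open>- y\<close>, which cannot be a bead together
        with \<open>y\<close>.\<close>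
      then consider "2 * t < y" | "0 < y" "y < 2 * t" | "y < 0" by linarith
      then show False
      proof cases
        case 1
        moreover have "0 \<le> t" using t by simp
        ultimately show False
          using descend[of t y] t y MD \<open>y - 2 * t \<notin> ?S\<close> by auto
      next
        case 2
        then show False
          using no_sum[of t y "2 * t - y"] t y z MD by simp
      next
        case 3
        moreover have "0 \<le> t" using t by simp
        ultimately have "2 * t - y - 2 * t \<in> MD lam"
          using descend[of t "2 * t - y"] t z MD by simp
        then show False
          using neg[OF odd_S[OF y]] y MD by simp
      qed
    qed
  qed
  finally show ?thesis .
qed

end
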